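(* Let $f\in \mathrm{Emb}(\mathbb{R}^2)$ be a map with symmetry group $\Gamma$ such that $\kappa\in\Gamma$, and suppose $\mathrm{Fix}(f)=\{0\}$. Suppose in addition that one of the following holds: a) $f\in \mathrm{Emb}^{+}(\mathbb{R}^2)$ and $f$ does not interchange the connected components of $\mathbb{R}^2\setminus \mathrm{Fix}\langle\kappa\rangle$; b) there exist no $2$-periodic orbits of $f$. Then, if $0$ is a local repellor for $f$, $0$ is a global repellor for $f$.
   Context: $\mathrm{Emb}(\mathbb{R}^2)$ is the set of continuous injective maps $f:\mathbb{R}^2\to\mathbb{R}^2$ (not necessarily onto), and $\mathrm{Emb}^+(\mathbb{R}^2)$ is the subset of orientation preserving ones. $\mathrm{Fix}(f)$ is the set of fixed points of $f$. A $2$-periodic orbit is the orbit of a point $p$ with $f^2(p)=p\neq f(p)$. An element $\gamma\in GL(2)$ is a symmetry of $f$ if $f(\gamma x)=\gamma f(x)$ for all $x\in\mathbb{R}^2$. The symmetry group of $f$ is the smallest closed subgroup of $GL(2)$ containing all symmetries of $f$; it is denoted $\Gamma$ and assumed to be a compact Lie group. $\kappa$ is the flip $\kappa(x,y)=(x,-y)$, and $\mathrm{Fix}\langle\kappa\rangle=\{p\in\mathbb{R}^2:\kappa p=p\}$ is the horizontal axis. "$f$ does not interchange the connected components of $\mathbb{R}^2\setminus\mathrm{Fix}\langle\kappa\rangle$" means that $f$ maps each of the two open half-planes into itself. $\omega(p)$ is the set of points $q\in\mathbb{R}^2$ for which there is a sequence $n_j\to+\infty$ with $f^{n_j}(p)\to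 q$. The point $0\in\mathrm{Fix}(f)$ is a local repellor if there exists a neighbourhood $V$ of $0$ such that $\omega(p)\cap V=\emptyset$ for all $0\neq p\in\mathbb{R}^2$, and a global repellor if this holds for $V=\mathbb{R}^2$ (that is, $\|f^n(p)\|\to\infty$ as $n\to\infty$ for all $p\neq 0$). *)

theory Defs
  imports "HOL-Complex_Analysis.Complex_Analysis" "HOL-Algebra.Group"
begin

type_synonym plane = "real ^ 2"

definition Fix :: "(plane \<Rightarrow> plane) \<Rightarrow> plane set" where
  "Fix f = {p. f p = p}"

definition Emb :: "(plane \<Rightarrow> plane) set" where
  "Emb = {f. continuous_on UNIV f \<and> inj f}"

definition to_complex :: "plane \<Rightarrow> complex" where
  "to_complex x = Complex (x $ 1) (x $ 2)"

text \<open>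
  An embedding need not be differentiable, so orientation is expressed by the local degree: \<open>f\<close>
  preserves orientation if its local degree at every point \<open>p\<close> is \<open>1\<close>. In the plane that degree
  is the number of times the image of a positively oriented circle about \<open>p\<close> winds around \<open>f p\<close>.
  By injectivity the image curve avoids \<open>f p\<close>, so the winding number is defined; it is \<open>1\<close>
  or \<open>-1\<close>, and it does not depend on \<open>p\<close> or on the radius.
\<close>

definition circle_about :: "plane \<Rightarrow> real \<Rightarrow> real \<Rightarrow> plane" where
  "circle_about p r t = p + r *\<^sub>R vector [cos (2 * pi * t), sin (2 * pi * t)]"

definition orientation_preserving :: "(plane \<Rightarrow> plane) \<Rightarrow> bool" where
  "orientation_preserving f \<longleftrightarrow>
     (\<forall>p. \<forall>r>0. winding_number (to_complex \<circ> f \<circ> circle_about p r) (to_complex (f p)) = 1)"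

lemma orientation_preserving_id: "orientation_preserving id"
proof -
  have "to_complex \<circ> id \<circ> circle_about p r = circlepath (to_complex p) r" for p r
    by (auto simp: fun_eq_iff to_complex_def circle_about_def circlepath complex_eq_iff
        Re_exp Im_exp mult_ac)
  then show ?thesis
    by (simp add: orientation_preserving_def winding_number_circlepath_centre)
qed

definition Emb_plus :: "(plane \<Rightarrow> plane) set" where
  "Emb_plus = {f \<in> Emb. orientation_preserving f}"

definition two_periodic_orbit :: "(plane \<Rightarrow> plane) \<Rightarrow> plane set \<Rightarrow> bool" where
  "two_periodic_orbit f S \<longleftrightarrow>
     (\<exists>p. f (f p) = p \<and> p \<noteq> f p \<and> S = range (\<lambda>n. (f ^^ n) p))"

definition GL2 :: "(real ^ 2 ^ 2) monoid" where
  "GL2 = \<lparr>carrier = {A. invertible A}, mult = (**), one = mat 1\<rparr>"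

definition symmetries :: "(plane \<Rightarrow> plane) \<Rightarrow> (real ^ 2 ^ 2) set" where
  "symmetries f = {A \<in> carrier GL2. \<forall>x. f (A *v x) = A *v f x}"

text \<open>
  ``Closed'' is meant in the topology of \<open>GL(2)\<close>. A closed subgroup of \<open>GL(2)\<close> is automatically
  a Lie group, so the symmetry group is a compact Lie group exactly when it is compact.
\<close>

definition closed_subgroup_GL2 :: "(real ^ 2 ^ 2) set \<Rightarrow> bool" where
  "closed_subgroup_GL2 H \<longleftrightarrow> subgroup H GL2 \<and> closedin (top_of_set (carrier GL2)) H"

definition symmetry_group :: "(plane \<Rightarrow> plane) \<Rightarrow> (real ^ 2 ^ 2) set" where
  "symmetry_group f = closed_subgroup_GL2 hull symmetries f"

definition kappa :: "real ^ 2 ^ 2" where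
  "kappa = vector [vector [1, 0], vector [0, -1]]"

definition Fix_kappa :: "plane set" where
  "Fix_kappa = {p. kappa *v p = p}"

definition not_interchanging :: "(plane \<Rightarrow> plane) \<Rightarrow> bool" where
  "not_interchanging f \<longleftrightarrow> (\<forall>C \<in> components (- Fix_kappa). f ` C \<subseteq> C)"

definition omega_limit :: "(plane \<Rightarrow> plane) \<Rightarrow> plane \<Rightarrow> plane set" where
  "omega_limit f p =
     {q. \<exists>n :: nat \<Rightarrow> nat. filterlim n at_top sequentially \<and> (\<lambda>j. (f ^^ n j) p) \<longlonglongrightarrow> q}"

definition repels_from :: "(plane \<Rightarrow> plane) \<Rightarrow> plane set \<Rightarrow> bool" where
  "repels_from f V \<longleftrightarrow> 0 \<in> Fix f \<and> (\<forall>p. p \<noteq> 0 \<longrightarrow> omega_limit f p \<inter> V = {})"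

definition local_repellor :: "(plane \<Rightarrow> plane) \<Rightarrow> bool" where
  "local_repellor f \<longleftrightarrow> (\<exists>V. 0 \<in> interior V \<and> repels_from f V)"

definition global_repellor :: "(plane \<Rightarrow> plane) \<Rightarrow> bool" where
  "global_repellor f \<longleftrightarrow> repels_from f UNIV"

lemma kappa_apply: "kappa *v p = vector [p $ 1, - (p $ 2)]"
  by (simp add: kappa_def vec_eq_iff forall_2 matrix_vector_mult_def sum_2)

lemma Fix_kappa_eq: "Fix_kappa = {p. p $ 2 = 0}"
  by (auto simp: Fix_kappa_def kappa_apply vec_eq_iff forall_2)

lemma omega_limit_empty_iff:
  "omega_limit f p = {} \<longleftrightarrow> filterlim (\<lambda>n. norm ((f ^^ n) p)) at_top sequentially"
proof
  assume L: "filterlim (\<lambda>n. norm ((f ^^ n) p)) at_top sequentially"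
  show "omega_limit f p = {}"
  proof (rule ccontr)
    assume "omega_limit f p \<noteq> {}"
    then obtain q n where n: "filterlim n at_top sequentially"
      and q: "(\<lambda>j. (f ^^ n j) p) \<longlonglongrightarrow> q"
      by (auto simp: omega_limit_def)
    have "filterlim (\<lambda>j. norm ((f ^^ n j) p)) at_top sequentially"
      using filterlim_compose[OF L n] .
    with tendsto_norm[OF q] show False
      using not_tendsto_and_filterlim_at_infinity[OF sequentially_bot]
        filterlim_at_top_imp_at_infinity by blast
  qed
next
  assume E: "omega_limit f p = {}"
  show "filterlim (\<lambda>n. norm ((f ^^ n) p)) at_top sequentially"
  proof (rule ccontr)
    assume "\<not> ?thesis"
    then obtain B where "\<not> (\<forall>\<^sub>F n in sequentially. B \<le> norm ((f ^^ n) p))"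
      by (auto simp: filterlim_at_top)
    then have "\<exists>\<^sub>\<infinity>n. norm ((f ^^ n) p) < B"
      by (simp add: not_eventually frequently_cofinite[symmetric] cofinite_eq_sequentially not_le)
    then have inf: "infinite {n. norm ((f ^^ n) p) < B}"
      by (simp add: frequently_cofinite)
    define r where "r = enumerate {n. norm ((f ^^ n) p) < B}"
    have r: "strict_mono r"
      unfolding r_def by (rule strict_mono_enumerate[OF inf])
    have "(f ^^ r k) p \<in> cball 0 B" for k
      using enumerate_in_set[OF inf, of k] by (auto simp: r_def)
    then have "\<forall>k. (\<lambda>k. (f ^^ r k) p) k \<in> cball 0 B"
      by blast
    then obtain q s where s: "strict_mono s" and q: "((\<lambda>k. (f ^^ r k) p) \<circ> s) \<longlonglongrightarrow> q"
      using compact_cball[of "0::plane" B, unfolded compact_def, rule_format,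
          of "\<lambda>k. (f ^^ r k) p"] by blast
    have "filterlim (r \<circ> s) at_top sequentially"
      using strict_mono_o[OF r s] by (rule filterlim_subseq)
    with q have "q \<in> omega_limit f p"
      unfolding omega_limit_def by (auto simp: o_def intro!: exI[of _ "\<lambda>j. r (s j)"])
    with E show False by simp
  qed
qed

lemma global_repellor_iff:
  "global_repellor f \<longleftrightarrow>
     0 \<in> Fix f \<and> (\<forall>p. p \<noteq> 0 \<longrightarrow> filterlim (\<lambda>n. norm ((f ^^ n) p)) at_top sequentially)"
  by (simp add: global_repellor_def repels_from_def omega_limit_empty_iff)

end

theory Submission imports Defs
begin

text \<open>
  The map commutes with the reflection \<open>\<kappa>\<close>. In case a) \<open>f\<close> itself, in case b) \<open>f \<circ> f\<close>, maps each open
  half-plane into itself and is increasing on the horizontal axis, hence leaves invariant both the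
  plane slit along the closed negative half-axis and the plane slit along the closed positive one.
  Either slit plane is homeomorphic to the plane and contains no fixed point, so Brouwer's lemma for
  fixed point free orientation preserving embeddings excludes limit points of orbits there. An orbit
  of a nonzero point can therefore only accumulate at \<open>0\<close>, which the local repellor excludes.

  Brouwer's lemma is proved by shortening cycles. A 2-cycle is impossible because the rotation
  of \<open>f z - z\<close> along a path from \<open>p\<close> to \<open>f p\<close> would have to equal its own negative. For a longer cycle
  through \<open>a\<close>, grow a ball about \<open>a\<close> until it touches its image, say at \<open>f y\<close> with \<open>y\<close> also on the
  sphere; pushing \<open>a\<close> to \<open>f y\<close> near a radius and then \<open>f y\<close> to \<open>f a\<close> near the image of another radius, both
  within sets disjoint from their images, creates no fixed points and removes one point from the cycle.
\<close>

subsection \<open>Degree one and fixed point free maps\<close>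

text \<open>Two logarithms of one function differ by integer multiples of
  \<open>2 * pi * \<i>\<close>. These values are discrete, so the difference is constant on a
  connected set.\<close>

lemma exp_eq_imp_const_diff:
  fixes g h :: "'a::topological_space \<Rightarrow> complex"
  assumes S: "connected S" "continuous_on S g" "continuous_on S h"
    and e: "\<And>x. x \<in> S \<Longrightarrow> exp (g x) = exp (h x)"
    and xy: "x \<in> S" "y \<in> S"
  shows "g x - h x = g y - h y"
proof -
  have "(\<lambda>x. g x - h x) constant_on S"
  proof (rule continuous_discrete_range_constant[OF S(1)])
    show "continuous_on S (\<lambda>x. g x - h x)"
      by (intro continuous_intros S)
    fix a assume a: "a \<in> S"
    show "\<exists>e>0. \<forall>b. b \<in> S \<and> g b - h b \<noteq> g a - h a \<longrightarrow> e \<le> norm (g b - h b - (g a - h a))"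
    proof (intro exI[of _ "2*pi"] conjI allI impI)
      fix b assume b: "b \<in> S \<and> g b - h b \<noteq> g a - h a"
      obtain m where m: "g a = h a + (of_int (2 * m) * pi) * \<i>"
        using e[OF a] by (auto simp: exp_eq)
      obtain n where n: "g b = h b + (of_int (2 * n) * pi) * \<i>"
        using e b by (auto simp: exp_eq)
      have d: "g b - h b - (g a - h a) = of_real (2 * pi * of_int (n - m)) * \<i>"
        by (simp add: m n algebra_simps)
      have "n \<noteq> m" using b m n by auto
      then have "1 \<le> \<bar>real_of_int (n - m)\<bar>" by linarith
      then have "2 * pi * 1 \<le> 2 * pi * \<bar>real_of_int (n - m)\<bar>"
        by (intro mult_left_mono) auto
      then show "2 * pi \<le> norm (g b - h b - (g a - h a))"
        unfolding d norm_mult norm_of_real by (simp add: abs_mult)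
    qed simp
  qed
  then show ?thesis using xy by (auto simp: constant_on_def)
qed

text \<open>
  Parametrising pairs of distinct points by \<open>(z, z + exp u)\<close> makes the parameter space contractible;
  periodicity in \<open>u\<close> then says that \<open>f\<close> preserves the rotation number of a pair of points
  about each other.
\<close>

definition secant_log :: "(complex \<Rightarrow> complex) \<Rightarrow> (complex \<times> complex \<Rightarrow> complex) \<Rightarrow> bool" where
  "secant_log f L \<longleftrightarrow> continuous_on UNIV L \<and>
     (\<forall>z u. exp (L (z, u)) = (f (z + exp u) - f z) / exp u) \<and>
     (\<forall>z u. L (z, u + 2 * pi * \<i>) = L (z, u))"

definition degree_one :: "(complex \<Rightarrow> complex) \<Rightarrow> bool" where
  "degree_one f \<longleftrightarrow> (\<exists>L. secant_log f L)"

text \<open>Chain rule for secants: \<open>u + L (z, u)\<close> is a logarithm of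
  \<open>f (z + exp u) - f z\<close>, so it is fed into \<open>M\<close> at the base point
  \<open>f z\<close>. It grows by \<open>2 * pi * \<i>\<close> together with \<open>u\<close>, which
  transfers periodicity.\<close>

lemma degree_one_comp:
  assumes f: "degree_one f" "continuous_on UNIV f" and g: "degree_one g"
  shows "degree_one (g \<circ> f)"
proof -
  obtain L where L: "continuous_on UNIV L"
    "\<And>z u. exp (L (z, u)) = (f (z + exp u) - f z) / exp u"
    "\<And>z u. L (z, u + 2 * pi * \<i>) = L (z, u)"
    using f by (auto simp: degree_one_def secant_log_def)
  obtain M where M: "continuous_on UNIV M"
    "\<And>z u. exp (M (z, u)) = (g (z + exp u) - g z) / exp u"
    "\<And>z u. M (z, u + 2 * pi * \<i>) = M (z, u)"
    using g by (auto simp: degree_one_def secant_log_def)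
  let ?N = "\<lambda>(z, u). M (f z, u + L (z, u)) + L (z, u)"
  have "continuous_on UNIV ?N"
    unfolding case_prod_unfold
    by (intro continuous_intros continuous_on_compose2[OF M(1)] continuous_on_compose2[OF L(1)]
        continuous_on_compose2[OF f(2)]) auto
  moreover have "exp (?N (z, u)) = ((g \<circ> f) (z + exp u) - (g \<circ> f) z) / exp u" for z u
  proof -
    have *: "exp (u + L (z, u)) = f (z + exp u) - f z"
      by (simp add: exp_add L)
    have "exp (?N (z, u)) = exp (M (f z, u + L (z, u))) * exp (L (z, u))"
      by (simp add: exp_add)
    also have "\<dots> = (g (f (z + exp u)) - g (f z)) / exp (u + L (z, u)) * exp (L (z, u))"
      unfolding M(2) using * by simp
    finally show ?thesis by (simp add: exp_add)
  qed
  moreover have "?N (z, u + 2 * pi * \<i>) = ?N (z, u)" for z u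
    using M(3)[of "f z" "u + L (z, u)"] L(3)[of z u] by (simp add: add_ac)
  ultimately show ?thesis
    unfolding degree_one_def secant_log_def by blast
qed

text \<open>A logarithm of the secant quotient exists on the contractible space of all
  \<open>(z, u)\<close>, and its change under \<open>u + 2 * pi * \<i>\<close> is constant.
  Periodicity can therefore be tested on a single circle about a single point.\<close>

lemma degree_one_criterion:
  assumes f: "continuous_on UNIV f" "inj f"
    and l: "continuous_on UNIV l" "l (2 * pi) = l 0"
    and el: "\<And>s::real. exp (l s) = (f (p + exp (u + \<i> * s)) - f p) / exp (u + \<i> * s)"
  shows "degree_one f"
proof -
  let ?q = "\<lambda>(z, u). (f (z + exp u) - f z) / exp u"
  have "continuous_on UNIV ?q"
    unfolding case_prod_unfold
    by (intro continuous_intros continuous_on_compose2[OF f(1)]) auto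
  moreover have "?q x \<noteq> 0" for x
    using injD[OF f(2), of "fst x + exp (snd x)" "fst x"] by (auto simp: case_prod_unfold)
  ultimately obtain L where L: "continuous_on UNIV L" "\<And>x. ?q x = exp (L x)"
    by (rule continuous_logarithm_on_contractible[OF _ contractible_UNIV]) auto
  let ?D = "\<lambda>(z, u). L (z, u + 2 * pi * \<i>)"
  have D: "?D x - L x = ?D y - L y" for x y
  proof (rule exp_eq_imp_const_diff[of UNIV])
    show "continuous_on UNIV ?D"
      unfolding case_prod_unfold
      by (intro continuous_intros continuous_on_compose2[OF L(1)]) auto
    show "exp (?D x) = exp (L x)" for x
      by (cases x) (simp add: L(2)[symmetric] exp_add)
  qed (use L connected_UNIV in auto)
  \<comment> \<open>On the test circle \<open>L\<close> and \<open>l\<close> are logarithms of the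
    same function of \<open>s\<close>, so they gain equally over one turn, and \<open>l\<close>
    gains nothing.\<close>
  have "L (p, u + \<i> * complex_of_real (2 * pi)) - l (2 * pi)
      = L (p, u + \<i> * complex_of_real 0) - l 0"
  proof (rule exp_eq_imp_const_diff[of UNIV "\<lambda>s. L (p, u + \<i> * complex_of_real s)" l])
    show "continuous_on UNIV (\<lambda>s. L (p, u + \<i> * complex_of_real s))"
      by (intro continuous_intros continuous_on_compose2[OF L(1)]) auto
    show "exp (L (p, u + \<i> * complex_of_real s)) = exp (l s)" for s
      by (simp add: L(2)[symmetric] el)
  qed (use l connected_UNIV in auto)
  then have "?D (p, u) - L (p, u) = 0"
    using l by (simp add: mult_ac)
  then have "L (z, v + 2 * pi * \<i>) = L (z, v)" for z v
    using D[of "(p, u)" "(z, v)"] by simp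
  then show ?thesis
    unfolding degree_one_def secant_log_def using L by (metis (mono_tags, lifting) case_prod_conv)
qed

text \<open>On a small circle about \<open>p\<close> inside \<open>S\<close> the secant quotient is
  \<open>1\<close>, with logarithm \<open>0\<close>; \<open>ln (e / 2)\<close> encodes the radius
  \<open>e / 2\<close>.\<close>

lemma degree_one_local_id:
  assumes f: "continuous_on UNIV f" "inj f" and S: "open S" "p \<in> S" "\<And>z. z \<in> S \<Longrightarrow> f z = z"
  shows "degree_one f"
proof -
  obtain e where e: "e > 0" "ball p e \<subseteq> S"
    using S openE by blast
  have n: "exp (of_real (ln (e / 2)) + \<i> * of_real s) \<in> ball 0 e" for s
    using e by (simp add: norm_exp_eq_Re)
  have "f (p + exp (of_real (ln (e / 2)) + \<i> * of_real s))
      = p + exp (of_real (ln (e / 2)) + \<i> * of_real s)" for s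
    by (rule S(3), rule subsetD[OF e(2)]) (use n[of s] in \<open>simp add: dist_norm\<close>)
  then show ?thesis
    using S(2,3)
    by (intro degree_one_criterion[OF f, of "\<lambda>_. 0" p "of_real (ln (e / 2))"]) auto
qed

definition brouwer_map :: "(complex \<Rightarrow> complex) \<Rightarrow> bool" where
  "brouwer_map f \<longleftrightarrow> continuous_on UNIV f \<and> inj f \<and> degree_one f \<and> (\<forall>z. f z \<noteq> z)"

lemma brouwer_map_no_2_cycle:
  assumes "brouwer_map f"
  shows "f (f p) \<noteq> p"
proof
  assume per: "f (f p) = p"
  have f: "continuous_on UNIV f" "inj f" "degree_one f" "\<And>z. f z \<noteq> z"
    using assms by (auto simp: brouwer_map_def)
  obtain L where L: "continuous_on UNIV L"
    "\<And>z u. exp (L (z, u)) = (f (z + exp u) - f z) / exp u"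
    "\<And>z u. L (z, u + 2 * pi * \<i>) = L (z, u)"
    using f by (auto simp: degree_one_def secant_log_def)
  \<comment> \<open>The displacement never vanishes on the contractible plane, so it has a global
    logarithm \<open>t\<close>.\<close>
  obtain t where t: "continuous_on UNIV t" "\<And>z. f z - z = exp (t z)"
  proof (rule continuous_logarithm_on_contractible[OF _ contractible_UNIV])
    show "continuous_on UNIV (\<lambda>z. f z - z)" by (intro continuous_intros f)
    show "f z - z \<noteq> 0" for z using f by simp
  qed auto
  \<comment> \<open>\<open>f\<close> carries the pair \<open>(z, f z)\<close> to
    \<open>(f z, f (f z))\<close>, so \<open>t z + L (z, t z)\<close> is a second logarithm of the
    displacement at \<open>f z\<close>.\<close>
  have t2: "t (f z) - (t z + L (z, t z)) = t (f w) - (t w + L (w, t w))" for z w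
  proof (rule exp_eq_imp_const_diff[of UNIV "\<lambda>z. t (f z)"])
    show "continuous_on UNIV (\<lambda>z. t (f z))"
      by (intro continuous_on_compose2[OF t(1)] f) auto
    show "continuous_on UNIV (\<lambda>z. t z + L (z, t z))"
      by (intro continuous_intros continuous_on_compose2[OF L(1)] t) auto
    fix z
    have "z + exp (t z) = f z" using t(2)[of z] by (simp add: algebra_simps)
    then show "exp (t (f z)) = exp (t z + L (z, t z))"
      by (simp add: exp_add L t(2)[symmetric])
  qed (use connected_UNIV in auto)
  \<comment> \<open>Exchanging the two points leaves the secant quotient unchanged, so it alters
    \<open>L\<close> by a constant. Exchanging twice is a full period, so that constant is its own
    negative.\<close>
  have Lsym: "L (z + exp u, u + pi * \<i>) = L (z, u)" for z u
  proof -
    let ?R = "\<lambda>(z, u). L (z + exp u, u + pi * \<i>)"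
    have R: "?R x - L x = ?R y - L y" for x y
    proof (rule exp_eq_imp_const_diff[of UNIV])
      show "continuous_on UNIV ?R"
        unfolding case_prod_unfold
        by (intro continuous_intros continuous_on_compose2[OF L(1)]) auto
      show "exp (?R x) = exp (L x)" for x
        by (cases x) (simp add: L exp_add minus_divide_left)
    qed (use L connected_UNIV in auto)
    have "?R (z + exp u, u + pi * \<i>) = L (z, u)"
      using L(3)[of z u] by (simp add: exp_add algebra_simps)
    then show ?thesis
      using R[of "(z, u)" "(z + exp u, u + pi * \<i>)"] by (simp add: algebra_simps)
  qed
  define q where "q = f p"
  have pq: "p + exp (t p) = q" using t(2)[of p] by (simp add: q_def algebra_simps)
  have "exp (t q) = p - q" using t(2)[of q] per by (simp add: q_def)
  also have "\<dots> = exp (t p + pi * \<i>)" using t(2)[of p, symmetric] by (simp add: q_def exp_add)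
  finally have "exp (t q) = exp (t p + pi * \<i>)" .
  then obtain m :: int where m: "t q = (t p + pi * \<i>) + (of_int (2 * m) * pi) * \<i>"
    by (auto simp: exp_eq)
  have Lper: "L (z, u + of_int m * (2 * pi * \<i>)) = L (z, u)" for z u
  proof -
    have N: "L (z, u + of_nat k * (2 * pi * \<i>)) = L (z, u)" for k u
      by (induction k) (use L(3) in \<open>simp_all add: algebra_simps\<close>, metis add.assoc add.commute)
    show ?thesis
    proof (cases "m \<ge> 0")
      case True then show ?thesis using N[of u "nat m"] by simp
    next
      case False then show ?thesis
        using N[of "u + of_int m * (2 * pi * \<i>)" "nat (- m)"] by (simp add: algebra_simps)
    qed
  qed
  \<comment> \<open>With equal \<open>L\<close>-terms, comparing \<open>t2\<close> at
    \<open>p\<close> and at \<open>q\<close> forces \<open>t p = t q\<close>, although the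
    displacements there are opposite and nonzero.\<close>
  have "L (q, t q) = L (q, t p + pi * \<i>)"
    using Lper[of q "t p + pi * \<i>"] m by (simp add: algebra_simps)
  also have "\<dots> = L (p, t p)" using Lsym[of p "t p"] pq by simp
  finally have "t q - t p = t p - t q"
    using t2[of p q] per by (simp add: q_def algebra_simps)
  then have "t p = t q" by (simp add: algebra_simps)
  then have "f p - p = p - f p"
    using t(2)[of p] t(2)[of q] per by (simp add: q_def)
  then show False using f(4)[of p] by (simp add: algebra_simps)
qed

text \<open>A homeomorphism with bounded support in \<open>S\<close> moves \<open>a\<close> to
  \<open>b\<close>; being the identity far out, it has degree one. A fixed point of
  \<open>\<phi> \<circ> f\<close> would be a point of \<open>S\<close> with image under
  \<open>f\<close> in \<open>S\<close>.\<close>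

lemma brouwer_map_push:
  assumes f: "brouwer_map f" and S: "open S" "connected S" "a \<in> S" "b \<in> S"
    and free: "f ` S \<inter> S = {}"
  obtains \<phi> where "brouwer_map (\<phi> \<circ> f)" "\<phi> a = b" "\<And>z. z \<notin> S \<Longrightarrow> \<phi> z = z"
proof -
  have aff: "affine hull S = UNIV"
    using affine_hull_open S by blast
  obtain \<phi> \<psi> where h: "homeomorphism UNIV UNIV \<phi> \<psi>" "\<phi> a = b"
    "{x. \<not> (\<phi> x = x \<and> \<psi> x = x)} \<subseteq> S" "bounded {x. \<not> (\<phi> x = x \<and> \<psi> x = x)}"
    using homeomorphism_moving_point[of S UNIV a b] S aff by (auto simp: openin_subtopology)
  have cont: "continuous_on UNIV \<phi>" and inj: "inj \<phi>"
    using h(1) by (auto simp: homeomorphism_def inj_def) metis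
  have id: "\<phi> z = z" if "z \<notin> S" for z
    using h(3) that by auto
  obtain B where B: "\<And>x. \<not> (\<phi> x = x \<and> \<psi> x = x) \<Longrightarrow> norm x \<le> B"
    using h(4) by (auto simp: bounded_iff)
  have "degree_one \<phi>"
  proof (rule degree_one_local_id[OF cont inj])
    show "open (- cball (0::complex) B)" by auto
    show "of_real (\<bar>B\<bar> + 1) \<in> - cball (0::complex) B" by auto
    show "\<phi> z = z" if "z \<in> - cball 0 B" for z
      using B[of z] that by auto
  qed
  moreover have "\<phi> (f z) \<noteq> z" for z
  proof
    assume e: "\<phi> (f z) = z"
    have "f z \<in> S"
    proof (rule ccontr)
      assume "f z \<notin> S"
      then show False using id e f by (auto simp: brouwer_map_def)
    qed
    \<comment> \<open>Otherwise \<open>\<phi> z = z = \<phi> (f z)\<close>, and injectivity makes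
      \<open>z\<close> a fixed point of \<open>f\<close>.\<close>
    moreover have "z \<in> S"
      using id[of z] e \<open>f z \<in> S\<close> inj by (metis injD)
    ultimately show False using free by blast
  qed
  ultimately have "brouwer_map (\<phi> \<circ> f)"
    using f cont inj degree_one_comp continuous_on_compose[of UNIV f \<phi>]
      continuous_on_subset[OF cont subset_UNIV]
    by (auto simp: brouwer_map_def inj_compose)
  then show thesis using that h(2) id by blast
qed

subsection \<open>Brouwer's lemma\<close>

text \<open>At the first return to \<open>S\<close> the orbit is pushed back to \<open>a\<close>
  inside \<open>S\<close>. Its earlier points after \<open>a\<close> avoid \<open>S\<close>, so the
  push does not affect them and the orbit closes up.\<close>

lemma free_return_imp_cycle:
  assumes f: "brouwer_map f" and S: "open S" "connected S" "f ` S \<inter> S = {}"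
    and a: "a \<in> S" "(f ^^ m) a \<in> S" "0 < m"
  obtains g k where "brouwer_map g" "0 < k" "k \<le> m" "(g ^^ k) a = a"
proof -
  define k where "k = (LEAST k. 0 < k \<and> (f ^^ k) a \<in> S)"
  have k: "0 < k" "(f ^^ k) a \<in> S" "k \<le> m"
    unfolding k_def using a LeastI[of "\<lambda>k. 0 < k \<and> (f ^^ k) a \<in> S" m]
    by (auto intro: Least_le)
  have notin: "(f ^^ j) a \<notin> S" if "0 < j" "j < k" for j
    using not_less_Least[of j "\<lambda>k. 0 < k \<and> (f ^^ k) a \<in> S"] that by (auto simp: k_def)
  obtain \<phi> where \<phi>: "brouwer_map (\<phi> \<circ> f)" "\<phi> ((f ^^ k) a) = a" "\<And>z. z \<notin> S \<Longrightarrow> \<phi> z = z"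
    using brouwer_map_push[OF f S(1,2) k(2) a(1) S(3)] by blast
  have "((\<phi> \<circ> f) ^^ j) a = (f ^^ j) a" if "j < k" for j
    using that
  proof (induction j)
    case (Suc j) then show ?case using notin[of "Suc j"] \<phi>(3) by simp
  qed simp
  then have "((\<phi> \<circ> f) ^^ k) a = a"
    using k(1) \<phi>(2) by (cases k) auto
  then show thesis using that \<phi>(1) k by blast
qed

section \<open>Balls touching their image, and neighbourhoods disjoint from it\<close>

text \<open>The radius at which a growing ball first meets its image is the minimum of
  \<open>max (dist x z) (dist x (f z))\<close> over \<open>z\<close>. At a minimiser both distances
  equal it, since otherwise the open ball would already meet its image.\<close>

lemma touching_ball:
  fixes f :: "'a::euclidean_space \<Rightarrow> 'a"
  assumes f: "continuous_on UNIV f" "inj f" "f x \<noteq> x"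
  obtains y r where "0 < r" "dist x y = r" "dist x (f y) = r" "f ` ball x r \<inter> ball x r = {}"
proof -
  define m where "m z = max (dist x z) (dist x (f z))" for z
  have cm: "continuous_on S m" for S
    unfolding m_def by (intro continuous_intros continuous_on_subset[OF f(1)]) auto
  \<comment> \<open>Outside this compact ball the first distance alone exceeds \<open>m x\<close>,
    so the minimum over the ball is global.\<close>
  obtain y where y: "y \<in> cball x (m x)" "\<And>z. z \<in> cball x (m x) \<Longrightarrow> m y \<le> m z"
    using continuous_attains_inf[OF compact_cball _ cm, of x "m x"] by (auto simp: m_def)
  have min: "m y \<le> m z" for z
  proof (cases "z \<in> cball x (m x)")
    case False
    then have "m x \<le> m z" by (auto simp: m_def)
    then show ?thesis using y(2)[of x] by (force simp: m_def)
  qed (use y in auto)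
  define r where "r = m y"
  have r: "r > 0"
    using f(3) by (auto simp: r_def m_def less_max_iff_disj)
  have fc: "isCont f z" for z
    using f(1) by (simp add: continuous_on_eq_continuous_at)
  have free: "f ` ball x r \<inter> ball x r = {}"
  proof -
    have "\<not> (dist x z < r \<and> dist x (f z) < r)" for z
      using min[of z] by (auto simp: r_def m_def)
    then show ?thesis by auto
  qed
  have le: "dist x y \<le> r" "dist x (f y) \<le> r" by (auto simp: r_def m_def)
  have near: "b \<in> closure (ball x r)" if "dist x b \<le> r" for b
    using r that by simp
  \<comment> \<open>If \<open>f y\<close> were in the open ball, so would be the images of points of
    the ball close to \<open>y\<close>.\<close>
  have 1: "dist x (f y) = r"
  proof (rule ccontr)
    assume "dist x (f y) \<noteq> r"
    then have "f y \<in> ball x r" using le by auto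
    then obtain U where U: "open U" "y \<in> U" "f ` U \<subseteq> ball x r"
      using continuous_on_open_vimage[of UNIV f] f(1)
      by (metis Int_UNIV_right image_vimage_subset open_ball open_UNIV vimageI)
    then have "U \<inter> ball x r \<noteq> {}"
      using near[OF le(1)] open_Int_closure_eq_empty[OF U(1), of "ball x r"] by blast
    then show False using U free by blast
  qed
  \<comment> \<open>If \<open>y\<close> were in the open ball, its image would be an open set around
    \<open>f y\<close>, which lies in the closure of the ball.\<close>
  have 2: "dist x y = r"
  proof (rule ccontr)
    assume "dist x y \<noteq> r"
    then have "f y \<in> f ` ball x r" using le by auto
    moreover have "open (f ` ball x r)"
      by (intro invariance_of_domain continuous_on_subset[OF f(1)] inj_on_subset[OF f(2)]) auto
    ultimately have "f ` ball x r \<inter> ball x r \<noteq> {}"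
      using near[OF le(2)] open_Int_closure_eq_empty[of "f ` ball x r" "ball x r"] by blast
    then show False using free by blast
  qed
  show thesis using that r 1 2 free by blast
qed

lemma connected_open_nbhd:
  fixes K :: "'a::euclidean_space set"
  assumes K: "connected K" "K \<noteq> {}" and W: "open W" "K \<subseteq> W"
  obtains T where "open T" "connected T" "K \<subseteq> T" "T \<subseteq> W"
proof -
  obtain x where x: "x \<in> K" using K by blast
  show thesis
  proof
    show "open (connected_component_set W x)" using W by (simp add: open_connected_component)
    show "connected (connected_component_set W x)" by simp
    show "K \<subseteq> connected_component_set W x"
      using connected_component_maximal[OF x K(1) W(2)] .
    show "connected_component_set W x \<subseteq> W"
      by (rule connected_component_subset)
  qed
qed

text \<open>Disjointness of compact sets persists under slight thickening; this turns the segments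
  used for pushing into open sets.\<close>

lemma disjoint_image_nbhd:
  fixes f :: "'a::euclidean_space \<Rightarrow> 'a"
  assumes f: "continuous_on UNIV f" and K: "compact K" "compact L" "f ` K \<inter> L = {}"
  obtains T M where "open T" "K \<subseteq> T" "open M" "L \<subseteq> M" "f ` T \<inter> M = {}"
proof -
  have "compact (f ` K)"
    using K f by (meson compact_continuous_image continuous_on_subset subset_UNIV)
  then obtain P Q where PQ: "open P" "open Q" "f ` K \<subseteq> P" "L \<subseteq> Q" "P \<inter> Q = {}"
    using separation_normal_compact[of "f ` K" L] K compact_imp_closed by metis
  show thesis
  proof
    show "open (f -` P)" using PQ f by (simp add: open_vimage)
  qed (use PQ in auto)
qed

lemma free_nbhd:
  fixes f :: "'a::euclidean_space \<Rightarrow> 'a"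
  assumes f: "continuous_on UNIV f" and K: "compact K" "connected K" "K \<noteq> {}"
    and L: "f ` K \<inter> K = {}" and W: "open W" "K \<subseteq> W"
  obtains T where "open T" "connected T" "K \<subseteq> T" "T \<subseteq> W" "f ` T \<inter> T = {}"
proof -
  obtain T M where T: "open T" "K \<subseteq> T" "open M" "K \<subseteq> M" "f ` T \<inter> M = {}"
    by (rule disjoint_image_nbhd[OF f K(1) K(1) L])
  have "open (T \<inter> M \<inter> W)" "K \<subseteq> T \<inter> M \<inter> W" using T W by auto
  then obtain S where S: "open S" "connected S" "K \<subseteq> S" "S \<subseteq> T \<inter> M \<inter> W"
    by (rule connected_open_nbhd[OF K(2,3)])
  show thesis
    by (rule that[of S]) (use S T in blast)+
qed

text \<open>The induction on the length runs over all maps at once, because shortening a cycle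
  changes the map.\<close>

theorem brouwer_map_no_cycle:
  assumes "brouwer_map f" "0 < n"
  shows "(f ^^ n) a \<noteq> a"
  using assms
proof (induction n arbitrary: f a rule: less_induct)
  case (less n)
  have IH: "(g ^^ k) b \<noteq> b" if "brouwer_map g" "0 < k" "k < n" for g k b
    using less.IH that by blast
  have f: "continuous_on UNIV f" "inj f" "\<And>z. f z \<noteq> z"
    using less.prems by (auto simp: brouwer_map_def)
  have f2: "f (f z) \<noteq> z" for z
    using brouwer_map_no_2_cycle less.prems by blast
  show ?case
  proof
    assume per: "(f ^^ n) a = a"
    have n: "n \<ge> 3"
    proof (rule ccontr)
      assume "\<not> 3 \<le> n"
      then have "n = 1 \<or> n = 2" using less.prems by linarith
      then show False using per f f2 by (auto simp: numeral_2_eq_2)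
    qed
    \<comment> \<open>An early return to a free connected open set would yield a cycle shorter than
      \<open>n\<close>. This keeps the rest of the cycle clear of both pushes.\<close>
    have noret: "(f ^^ j) b \<notin> S"
      if S: "open S" "connected S" "f ` S \<inter> S = {}" "b \<in> S" "0 < j" "j < n" for S j b
    proof
      assume "(f ^^ j) b \<in> S"
      then obtain g k where "brouwer_map g" "0 < k" "k \<le> j" "(g ^^ k) b = b"
        by (rule free_return_imp_cycle[OF less.prems(1) S(1-4) _ S(5)])
      then show False using IH[of g k b] S(6) by linarith
    qed
    obtain y r where r: "0 < r" and y: "dist a y = r" "dist a (f y) = r"
      and free: "f ` ball a r \<inter> ball a r = {}"
      using touching_ball[OF f(1,2,3)] by metis
    define B where "B = ball a r"
    have B: "open B" "connected B" "f ` B \<inter> B = {}" "a \<in> B" "closure B = cball a r"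
      using r free by (auto simp: B_def)
    have opf: "open (f ` S)" if "open S" for S
      by (intro invariance_of_domain continuous_on_subset[OF f(1)] inj_on_subset[OF f(2)] that) auto
    \<comment> \<open>Disjointness of \<open>B\<close> and its image extends to the boundary on one
      side at a time: \<open>K1\<close> closes the source and \<open>K2\<close> the target.\<close>
    have K1: "f z \<notin> B" if "z \<in> cball a r" for z
    proof
      assume "f z \<in> B"
      moreover have "open (f -` B)" using B f open_vimage by blast
      ultimately have "f -` B \<inter> B \<noteq> {}"
        using that open_Int_closure_eq_empty[of "f -` B" B] unfolding B(5) by blast
      then show False using B(3) by blast
    qed
    have K2: "f z \<notin> cball a r" if "z \<in> B" for z
    proof
      assume "f z \<in> cball a r"
      then have "f ` B \<inter> B \<noteq> {}"
        using that open_Int_closure_eq_empty[OF opf[OF B(1)], of B] unfolding B(5) by blast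
      then show False using B(3) by blast
    qed
    \<comment> \<open>A return after two steps is excluded because \<open>n\<close> is at least
      3.\<close>
    have K3: "f (f z) \<notin> B" if "z \<in> B" for z
      using noret[OF B(1-3) that, of 2] n by (simp add: numeral_2_eq_2)
    have seg: "z = p \<or> z \<in> B" if "z \<in> closed_segment a p" "dist a p = r" for z p
    proof (cases "z = p")
      case False
      then have "z = a \<or> z \<in> open_segment a p"
        using that by (auto simp: open_segment_def)
      then show ?thesis
        using that r dist_in_open_segment[of z a p] by (auto simp: B_def dist_commute)
    qed simp
    have sph: "y \<notin> B" "f y \<notin> B" "y \<in> cball a r" "f y \<in> cball a r"
      "\<And>z. z \<in> B \<Longrightarrow> z \<in> cball a r" using y by (auto simp: B_def)
    have "f ` closed_segment a (f y) \<inter> closed_segment a (f y) = {}"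
    proof -
      have "f z \<noteq> w" if "z = f y \<or> z \<in> B" "w = f y \<or> w \<in> B" for z w
        using that K1 K2 sph f(3) by metis
      then show ?thesis using seg y by blast
    qed
    then obtain T1 where T1: "open T1" "connected T1" "closed_segment a (f y) \<subseteq> T1" "f ` T1 \<inter> T1 = {}"
      using free_nbhd[OF f(1), of "closed_segment a (f y)" UNIV] by auto
    \<comment> \<open>This separates the two pushes: near the radius to \<open>y\<close>, the second
      image will avoid the set in which the first push acts.\<close>
    have "(f \<circ> f) ` closed_segment a y \<inter> closed_segment a (f y) = {}"
    proof -
      have "f (f z) \<noteq> w" if "z = y \<or> z \<in> B" "w = f y \<or> w \<in> B" for z w
      proof (cases "z = y")
        case True then show ?thesis using that K1[OF sph(4)] f(3) by metis
      next
        case False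
        then have z: "z \<in> B" using that by blast
        have "f (f z) \<noteq> f y" using K2[OF z] sph(3) injD[OF f(2), of "f z" y] by metis
        then show ?thesis using that K3[OF z] by metis
      qed
      then have "(f \<circ> f) z \<notin> closed_segment a (f y)" if "z \<in> closed_segment a y" for z
        using seg[OF that y(1)] seg[OF _ y(2), of "(f \<circ> f) z"] by (metis comp_apply)
      then show ?thesis by blast
    qed
    note D = this
    have ff: "continuous_on UNIV (f \<circ> f)"
      using continuous_on_compose[OF f(1) continuous_on_subset[OF f(1)]] by simp
    obtain C1 M where C1: "open C1" "closed_segment a y \<subseteq> C1"
      and M: "open M" "closed_segment a (f y) \<subseteq> M" "(f \<circ> f) ` C1 \<inter> M = {}"
      by (rule disjoint_image_nbhd[OF ff compact_segment compact_segment D])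
    have "f ` closed_segment a y \<inter> closed_segment a y = {}"
    proof -
      have "f z \<noteq> w" if "z = y \<or> z \<in> B" "w = y \<or> w \<in> B" for z w
        using that K1 K2 sph f(3) by metis
      then show ?thesis using seg y by blast
    qed
    then obtain C where C: "open C" "connected C" "closed_segment a y \<subseteq> C" "C \<subseteq> C1" "f ` C \<inter> C = {}"
      by (rule free_nbhd[OF f(1) compact_segment connected_segment _ _ C1, rotated]) simp_all
    \<comment> \<open>\<open>T1\<close> is cut down by \<open>M\<close> so that
      \<open>f (f z)\<close> avoids \<open>T\<close> for every \<open>z\<close> in
      \<open>C\<close>.\<close>
    obtain T where T: "open T" "connected T" "closed_segment a (f y) \<subseteq> T" "T \<subseteq> T1 \<inter> M"
      by (rule connected_open_nbhd[OF connected_segment _ open_Int[OF T1(1) M(1)]])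
        (use T1(3) M(2) in simp_all)
    have aT: "a \<in> T" "f y \<in> T" using T by auto
    moreover have "f ` T \<inter> T = {}" using T(4) T1(4) by blast
    ultimately have aT: "a \<in> T" "f y \<in> T" "f ` T \<inter> T = {}" by auto
    have aC: "a \<in> C" "y \<in> C" using C by auto
    have CT: "f (f z) \<notin> T" if "z \<in> C" for z
    proof -
      have "(f \<circ> f) z \<in> (f \<circ> f) ` C1" using that C(4) by blast
      then have "(f \<circ> f) z \<notin> M" using M(3) by blast
      then show ?thesis using T(4) by auto
    qed
    obtain \<phi> where \<phi>: "brouwer_map (\<phi> \<circ> f)" "\<phi> a = f y" "\<And>z. z \<notin> T \<Longrightarrow> \<phi> z = z"
      using brouwer_map_push[OF less.prems(1) T(1,2) aT] by blast
    have Cfree: "(\<phi> \<circ> f) ` (f ` C) \<inter> f ` C = {}"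
      using CT \<phi>(3) C(5) f(2) by (auto dest!: injD[OF f(2)])
    have connfC: "connected (f ` C)"
      using C f by (meson connected_continuous_image continuous_on_subset subset_UNIV)
    obtain \<psi> where \<psi>: "brouwer_map (\<psi> \<circ> (\<phi> \<circ> f))" "\<psi> (f y) = f a" "\<And>z. z \<notin> f ` C \<Longrightarrow> \<psi> z = z"
      using brouwer_map_push[OF \<phi>(1) opf[OF C(1)] connfC imageI imageI Cfree] aC by blast
    define g where "g = \<psi> \<circ> (\<phi> \<circ> f)"
    \<comment> \<open>Along the cycle from \<open>f a\<close> up to \<open>(f ^^ (n - 1)) a\<close>
      neither push acts. The next step reaches \<open>a\<close>, which is pushed to
      \<open>f y\<close> and then to \<open>f a\<close>: the cycle skips \<open>a\<close> and has
      length \<open>n - 1\<close>.\<close>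
    have g: "(g ^^ j) (f a) = (f ^^ Suc j) a" if "j \<le> n - 2" for j
      using that
    proof (induction j)
      case (Suc j)
      have 1: "(f ^^ Suc (Suc j)) a \<notin> T"
        using noret[OF T(1,2) aT(3,1), of "Suc (Suc j)"] Suc.prems n by linarith
      have "(f ^^ Suc j) a \<notin> C"
        using noret[OF C(1,2,5) aC(1), of "Suc j"] Suc.prems n by linarith
      then have 2: "(f ^^ Suc (Suc j)) a \<notin> f ` C"
        using f(2) by (auto dest!: injD[OF f(2)])
      show ?case using Suc 1 2 \<phi>(3) \<psi>(3) by (simp add: g_def)
    qed simp
    have "(g ^^ (n - 2)) (f a) = (f ^^ (n - 1)) a"
      using g[of "n - 2"] n by (simp add: Suc_diff_le[symmetric] del: funpow.simps)
    moreover have "f ((f ^^ (n - 1)) a) = a"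
      using per n by (cases n) auto
    ultimately have "(g ^^ Suc (n - 2)) (f a) = f a"
      using \<phi>(2) \<psi>(2) by (simp add: g_def)
    moreover have "Suc (n - 2) < n" using n by linarith
    ultimately show False using IH[OF \<psi>(1)[folded g_def] zero_less_Suc] by blast
  qed
qed

text \<open>A limit point is not fixed, so it has a free connected neighbourhood. Two visits to it
  at different times give a return, hence a cycle of some fixed point free map.\<close>

corollary brouwer_map_no_limit:
  assumes f: "brouwer_map f" and r: "filterlim r at_top sequentially"
  shows "\<not> (\<lambda>j. (f ^^ r j) p) \<longlonglongrightarrow> q"
proof
  assume lim: "(\<lambda>j. (f ^^ r j) p) \<longlonglongrightarrow> q"
  have c: "continuous_on UNIV f" and nf: "f q \<noteq> q" using f by (auto simp: brouwer_map_def)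
  obtain T where T: "open T" "connected T" "q \<in> T" "f ` T \<inter> T = {}"
    using free_nbhd[OF c, of "{q}" UNIV] nf by auto
  have ev: "\<forall>\<^sub>F j in sequentially. (f ^^ r j) p \<in> T"
    using topological_tendstoD[OF lim T(1,3)] .
  then obtain i where i: "\<And>j. j \<ge> i \<Longrightarrow> (f ^^ r j) p \<in> T"
    by (auto simp: eventually_sequentially)
  \<comment> \<open>The times \<open>r\<close> need not be monotone, so a later index with a
    strictly larger time is selected.\<close>
  have "\<forall>\<^sub>F j in sequentially. r i < r j \<and> i \<le> j"
    using filterlim_at_top[THEN iffD1, OF r, rule_format, of "Suc (r i)"]
    by (intro eventually_conj eventually_ge_at_top) (simp add: Suc_le_eq)
  then obtain j where j: "r i < r j" "i \<le> j"
    using eventually_happens'[OF sequentially_bot] by blast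
  have "(f ^^ r j) p = (f ^^ (r j - r i)) ((f ^^ r i) p)"
    using j by (metis add_diff_inverse_nat add.commute funpow_add o_apply not_less_iff_gr_or_eq)
  then have "(f ^^ (r j - r i)) ((f ^^ r i) p) \<in> T" using i[OF j(2)] by simp
  then show False
    using free_return_imp_cycle[OF f T(1,2,4) i[OF order_refl], of "r j - r i"] j
      brouwer_map_no_cycle by (metis zero_less_diff)
qed

subsection \<open>Slit planes\<close>

text \<open>Since \<open>sgn 0 = 0\<close>, the single sign equation expresses invariance of both
  open half-planes and of the real axis.\<close>

definition half_plane_map :: "(complex \<Rightarrow> complex) \<Rightarrow> bool" where
  "half_plane_map F \<longleftrightarrow> continuous_on UNIV F \<and> inj F \<and> (\<forall>z. sgn (Im (F z)) = sgn (Im z)) \<and>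
     (\<forall>x y. x < y \<longrightarrow> Re (F (complex_of_real x)) < Re (F (complex_of_real y)))"

lemma divide_notin_nonpos_Reals:
  assumes "sgn (Im w) = sgn (Im z)" "Im z = 0 \<Longrightarrow> sgn (Re w) = sgn (Re z)" "z \<noteq> 0"
  shows "w / z \<notin> \<real>\<^sub>\<le>\<^sub>0"
proof
  assume "w / z \<in> \<real>\<^sub>\<le>\<^sub>0"
  then obtain t where t: "t \<le> 0" "w / z = of_real t" by (auto elim: nonpos_Reals_cases)
  then have w: "w = of_real t * z" using assms(3) by (simp add: field_simps)
  have s: "sgn t = 0 \<or> sgn t = -1" using t(1) by (auto simp: sgn_if)
  show False
  proof (cases "Im z = 0")
    case True
    then have "Re z \<noteq> 0" using assms(3) by (simp add: complex_eq_iff)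
    then show False using assms(2)[OF True] s by (auto simp: w sgn_mult sgn_0_0)
  next
    case False
    then show False using assms(1) s by (auto simp: w sgn_mult sgn_0_0)
  qed
qed

text \<open>On the unit circle about \<open>0\<close> the secant of \<open>F\<close> never points
  opposite to that of the identity. The quotient thus avoids the cut of \<open>Ln\<close>, and the
  principal logarithm is automatically periodic.\<close>

lemma half_plane_map_degree_one:
  assumes "half_plane_map F"
  shows "degree_one F"
proof -
  have F: "continuous_on UNIV F" "inj F" "\<And>z. sgn (Im (F z)) = sgn (Im z)"
    "\<And>x y. x < y \<Longrightarrow> Re (F (complex_of_real x)) < Re (F (complex_of_real y))"
    using assms by (auto simp: half_plane_map_def)
  define q where "q s = (F (exp (\<i> * of_real s)) - F 0) / exp (\<i> * of_real s)" for s :: real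
  have I0: "Im (F 0) = 0" using F(3)[of 0] by (simp add: sgn_0_0)
  have q: "q s \<notin> \<real>\<^sub>\<le>\<^sub>0" for s
    unfolding q_def
  proof (rule divide_notin_nonpos_Reals)
    let ?z = "exp (\<i> * of_real s)"
    show "sgn (Im (F ?z - F 0)) = sgn (Im ?z)" using F(3) I0 by simp
    show "sgn (Re (F ?z - F 0)) = sgn (Re ?z)" if "Im ?z = 0"
    proof -
      define x where "x = Re ?z"
      have z: "?z = of_real x" using that by (simp add: complex_eq_iff x_def)
      then have "x \<noteq> 0" by (metis exp_not_eq_zero of_real_0)
      then have "sgn (Re (F (of_real x) - F 0)) = sgn x"
        using F(4)[of x 0] F(4)[of 0 x] by (cases x "0::real" rule: linorder_cases) auto
      then show ?thesis by (simp add: z)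
    qed
  qed simp
  have "continuous_on UNIV q"
    unfolding q_def by (intro continuous_intros continuous_on_compose2[OF F(1)]) auto
  then have "continuous_on UNIV (\<lambda>s. Ln (q s))"
    using q by (intro continuous_intros) auto
  moreover have "exp (Ln (q s)) = (F (0 + exp (0 + \<i> * of_real s)) - F 0) / exp (0 + \<i> * of_real s)" for s
  proof -
    have "q s \<noteq> 0" using q[of s] by auto
    then show ?thesis by (simp add: q_def)
  qed
  moreover have "q (2 * pi) = q 0"
    using exp_two_pi_i' by (simp add: q_def mult_ac)
  ultimately show ?thesis
    by (intro degree_one_criterion[OF F(1,2), of "\<lambda>s. Ln (q s)" 0 0]) auto
qed

text \<open>The exponential in the real part maps the plane onto the right half-plane, and squaring
  maps that onto the plane slit along the nonpositive reals. Unlike \<open>exp\<close>, this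
  respects the sign of the imaginary part on the whole plane.\<close>

definition slit_param :: "complex \<Rightarrow> complex" where
  "slit_param z = (Complex (exp (Re z)) (Im z))\<^sup>2"

definition slit_chart :: "complex \<Rightarrow> complex" where
  "slit_chart c = Complex (ln (Re (csqrt c))) (Im (csqrt c))"

lemma slit_param:
  "slit_param z \<notin> \<real>\<^sub>\<le>\<^sub>0" "slit_chart (slit_param z) = z" "sgn (Im (slit_param z)) = sgn (Im z)"
proof -
  show "slit_param z \<notin> \<real>\<^sub>\<le>\<^sub>0"
    by (auto simp: slit_param_def complex_nonpos_Reals_iff power2_eq_square not_le)
  show "slit_chart (slit_param z) = z"
    by (simp add: slit_param_def slit_chart_def csqrt_square complex_eq_iff)
  show "sgn (Im (slit_param z)) = sgn (Im z)"
    by (simp add: slit_param_def power2_eq_square sgn_mult)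
qed

lemma Re_csqrt_pos:
  assumes "c \<notin> \<real>\<^sub>\<le>\<^sub>0"
  shows "0 < Re (csqrt c)"
proof (rule ccontr)
  assume "\<not> 0 < Re (csqrt c)"
  then have "Re (csqrt c) = 0" using Re_csqrt[of c] by linarith
  then have "(csqrt c)\<^sup>2 \<in> \<real>\<^sub>\<le>\<^sub>0"
    by (auto simp: complex_nonpos_Reals_iff power2_eq_square)
  then show False using assms by simp
qed

lemma slit_chart:
  assumes "c \<notin> \<real>\<^sub>\<le>\<^sub>0"
  shows "slit_param (slit_chart c) = c" "sgn (Im (slit_chart c)) = sgn (Im c)"
proof -
  have "Complex (Re (csqrt c)) (Im (csqrt c)) = csqrt c" by (simp add: complex_eq_iff)
  then show 1: "slit_param (slit_chart c) = c"
    using Re_csqrt_pos[OF assms] by (simp add: slit_param_def slit_chart_def)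
  show "sgn (Im (slit_chart c)) = sgn (Im c)"
    using slit_param(3)[of "slit_chart c"] 1 by simp
qed

lemma continuous_on_slit_param: "continuous_on UNIV slit_param"
  unfolding slit_param_def Complex_eq by (intro continuous_intros)

lemma continuous_on_slit_chart: "continuous_on (- \<real>\<^sub>\<le>\<^sub>0) slit_chart"
  unfolding slit_chart_def Complex_eq
  by (intro continuous_intros) (use Re_csqrt_pos in \<open>auto simp: less_le\<close>)

text \<open>In the slit chart \<open>F\<close> becomes a fixed point free half-plane map of the
  whole plane, and a limit point off the slit would become a limit point there.\<close>

lemma half_plane_map_limit_nonpos:
  assumes F: "half_plane_map F" "F 0 = 0" "\<And>z. F z = z \<Longrightarrow> z = 0"
    and c: "c \<notin> \<real>\<^sub>\<le>\<^sub>0" and r: "filterlim r at_top sequentially"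
    and lim: "(\<lambda>j. (F ^^ r j) c) \<longlonglongrightarrow> q"
  shows "q \<in> \<real>\<^sub>\<le>\<^sub>0"
proof (rule ccontr)
  assume q: "q \<notin> \<real>\<^sub>\<le>\<^sub>0"
  have F': "continuous_on UNIV F" "inj F" "\<And>z. sgn (Im (F z)) = sgn (Im z)"
    "\<And>x y. x < y \<Longrightarrow> Re (F (complex_of_real x)) < Re (F (complex_of_real y))"
    using F by (auto simp: half_plane_map_def)
  have real: "F (of_real x) = of_real (Re (F (of_real x)))" for x :: real
    using F'(3)[of "of_real x"] by (simp add: complex_eq_iff sgn_0_0)
  \<comment> \<open>The slit plane is forward invariant: off the axis by the sign condition, on the
    positive axis by monotonicity and \<open>F 0 = 0\<close>.\<close>
  have inv: "F z \<notin> \<real>\<^sub>\<le>\<^sub>0" if "z \<notin> \<real>\<^sub>\<le>\<^sub>0" for z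
  proof (cases "Im z = 0")
    case True
    then have "z = of_real (Re z)" "Re z > 0"
      using that by (auto simp: complex_eq_iff complex_nonpos_Reals_iff)
    then show ?thesis
      using F'(4)[of 0 "Re z"] F(2) by (simp add: complex_nonpos_Reals_iff)
  next
    case False
    then have "Im (F z) \<noteq> 0" using F'(3)[of z] by (metis sgn_0_0)
    then show ?thesis by (simp add: complex_nonpos_Reals_iff)
  qed
  have invn: "(F ^^ n) c \<notin> \<real>\<^sub>\<le>\<^sub>0" for n
    by (induction n) (use c inv in auto)
  define G where "G = slit_chart \<circ> F \<circ> slit_param"
  \<comment> \<open>On the axis the parametrisation and the chart are increasing real functions, so
    \<open>G\<close> inherits monotonicity from \<open>F\<close>.\<close>
  have slit_param_real: "slit_param (of_real x) = of_real ((exp x)\<^sup>2)" for x :: real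
    by (simp add: slit_param_def complex_eq_iff power2_eq_square)
  have slit_chart_real: "Re (slit_chart (of_real x)) = ln (sqrt x)" if "x > 0" for x :: real
    using that by (simp add: slit_chart_def)
  have "half_plane_map G"
    unfolding half_plane_map_def
  proof (intro conjI allI impI)
    have "continuous_on UNIV (\<lambda>z. slit_chart (F (slit_param z)))"
      using inv slit_param(1)
      by (intro continuous_on_compose2[OF continuous_on_slit_chart]
          continuous_on_compose2[OF F'(1)] continuous_on_slit_param) auto
    then show "continuous_on UNIV G" by (simp add: G_def o_def)
    show "inj G"
      by (rule injI) (metis G_def comp_apply inv slit_param(1,2) slit_chart(1) injD[OF F'(2)])
    show "sgn (Im (G z)) = sgn (Im z)" for z
      by (simp add: G_def slit_chart(2) inv slit_param F'(3))
    fix x y :: real assume "x < y"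
    have pos: "0 < Re (F (of_real ((exp t)\<^sup>2)))" for t :: real
      using F'(4)[of 0 "(exp t)\<^sup>2"] F(2) by simp
    have G: "Re (G (of_real t)) = ln (sqrt (Re (F (of_real ((exp t)\<^sup>2)))))" for t :: real
      using pos[of t] by (simp only: G_def comp_apply slit_param_real) (subst real, simp only: slit_chart_real)
    have "(exp x)\<^sup>2 < (exp y)\<^sup>2"
      using \<open>x < y\<close> by (simp add: power_strict_mono)
    then have "Re (F (of_real ((exp x)\<^sup>2))) < Re (F (of_real ((exp y)\<^sup>2)))"
      by (rule F'(4))
    then show "Re (G x) < Re (G y)"
      unfolding G using pos[of x] pos[of y] by simp
  qed
  then have "brouwer_map G"
  proof -
    have "G z \<noteq> z" for z
    proof
      assume "G z = z"
      then have "slit_param (slit_chart (F (slit_param z))) = slit_param z" by (simp add: G_def)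
      then have "F (slit_param z) = slit_param z" by (simp add: slit_chart inv slit_param)
      then have "slit_param z = 0" by (rule F(3))
      then show False using slit_param(1)[of z] by simp
    qed
    then show ?thesis
      using \<open>half_plane_map G\<close> half_plane_map_degree_one
      by (auto simp: brouwer_map_def half_plane_map_def)
  qed
  moreover have "(G ^^ n) (slit_chart c) = slit_chart ((F ^^ n) c)" for n
    by (induction n) (simp_all add: G_def slit_chart invn)
  moreover have "(\<lambda>j. slit_chart ((F ^^ r j) c)) \<longlonglongrightarrow> slit_chart q"
    by (rule continuous_on_tendsto_compose[OF continuous_on_slit_chart lim]) (use q invn in auto)
  ultimately show False
    using brouwer_map_no_limit[of G, OF _ r, of "slit_chart c" "slit_chart q"] by simp
qed

text \<open>Both slits are used, the second via conjugation by \<open>z \<mapsto> - z\<close>; a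
  limit point lying on both slits is \<open>0\<close>.\<close>

lemma half_plane_map_limit_zero:
  assumes F: "half_plane_map F" "F 0 = 0" "\<And>z. F z = z \<Longrightarrow> z = 0"
    and c: "c \<noteq> 0" and r: "filterlim r at_top sequentially"
    and lim: "(\<lambda>j. (F ^^ r j) c) \<longlonglongrightarrow> q"
  shows "q = 0"
proof -
  \<comment> \<open>Taking \<open>neg\<close> as a premise lets the claim be applied to
    \<open>F\<close> and to its conjugate alike.\<close>
  have wlog: "q = 0"
    if F: "half_plane_map F" "F 0 = 0" "\<And>z. F z = z \<Longrightarrow> z = 0"
      and c: "c \<notin> \<real>\<^sub>\<le>\<^sub>0" and lim: "(\<lambda>j. (F ^^ r j) c) \<longlonglongrightarrow> q"
      and neg: "half_plane_map (\<lambda>z. - F (- z))" for F c q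
  proof -
    have "q \<in> \<real>\<^sub>\<le>\<^sub>0" by (rule half_plane_map_limit_nonpos[OF F c r lim])
    moreover have "q \<in> \<real>\<^sub>\<ge>\<^sub>0"
    proof (cases "c \<in> \<real>\<^sub>\<ge>\<^sub>0")
      \<comment> \<open>Here the start lies on the second slit itself. Its orbit stays on this
        closed half-axis, and so does the limit.\<close>
      case True
      have step: "F z \<in> \<real>\<^sub>\<ge>\<^sub>0" if "z \<in> \<real>\<^sub>\<ge>\<^sub>0" for z
      proof -
        have z: "Im z = 0" "0 \<le> Re z" "z = of_real (Re z)"
          using that by (auto simp: complex_nonneg_Reals_iff complex_eq_iff)
        then have "Im (F z) = 0" using F(1) unfolding half_plane_map_def by (metis sgn_0_0)
        moreover have "0 \<le> Re (F z)"
        proof (cases "Re z = 0")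
          case True then show ?thesis using z F(2) by simp
        next
          case False
          then have "Re (F (of_real 0)) < Re (F (of_real (Re z)))"
            using F(1) z(2) unfolding half_plane_map_def by (metis less_le)
          then show ?thesis using z(3) F(2) by simp
        qed
        ultimately show ?thesis by (simp add: complex_nonneg_Reals_iff)
      qed
      have "(F ^^ n) c \<in> \<real>\<^sub>\<ge>\<^sub>0" for n
        by (induction n) (use True step in auto)
      then show ?thesis
        by (intro Lim_in_closed_set[OF closed_nonneg_Reals_complex _ _ lim]) auto
    next
      case False
      let ?F = "\<lambda>z. - F (- z)"
      have it: "(?F ^^ n) (- c) = - (F ^^ n) c" for n by (induction n) auto
      have "- q \<in> \<real>\<^sub>\<le>\<^sub>0"
      proof (rule half_plane_map_limit_nonpos[OF neg _ _ _ r])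
        show "z = 0" if "?F z = z" for z using F(3)[of "- z"] that by (metis minus_minus neg_equal_0_iff_equal)
        show "- c \<notin> \<real>\<^sub>\<le>\<^sub>0" using False by (auto simp: complex_nonneg_Reals_iff complex_nonpos_Reals_iff)
        show "(\<lambda>j. (?F ^^ r j) (- c)) \<longlonglongrightarrow> - q" unfolding it by (intro tendsto_intros lim)
      qed (use F in auto)
      then show ?thesis by (auto simp: complex_nonneg_Reals_iff complex_nonpos_Reals_iff)
    qed
    ultimately show ?thesis
      by (auto simp: complex_nonneg_Reals_iff complex_nonpos_Reals_iff complex_eq_iff)
  qed
  let ?F = "\<lambda>z. - F (- z)"
  have neg: "half_plane_map ?F"
    unfolding half_plane_map_def
  proof (intro conjI allI impI)
    have cF: "continuous_on UNIV F" and iF: "inj F" using F by (auto simp: half_plane_map_def)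
    show "continuous_on UNIV ?F"
      by (intro continuous_intros continuous_on_compose2[OF cF]) auto
    show "inj ?F" using iF by (auto simp: inj_def) (metis minus_minus)
    show "sgn (Im (?F z)) = sgn (Im z)" for z
      using F(1) by (simp add: half_plane_map_def sgn_minus)
    show "Re (?F x) < Re (?F y)" if "x < y" for x y :: real
    proof -
      have "- y < - x" using that by simp
      then have "Re (F (of_real (- y))) < Re (F (of_real (- x)))"
        using F(1) unfolding half_plane_map_def by blast
      then show ?thesis by simp
    qed
  qed
  show ?thesis
  proof (cases "c \<in> \<real>\<^sub>\<le>\<^sub>0")
    case False
    then show ?thesis using wlog[OF F _ lim neg] by simp
  next
    case True
    have it: "(?F ^^ n) (- c) = - (F ^^ n) c" for n by (induction n) auto
    have "- q = 0"
    proof (rule wlog[OF neg])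
      show "z = 0" if "?F z = z" for z using F(3)[of "- z"] that by (metis minus_minus neg_equal_0_iff_equal)
      show "- c \<notin> \<real>\<^sub>\<le>\<^sub>0"
        using True c by (auto simp: complex_nonpos_Reals_iff complex_eq_iff)
      show "(\<lambda>j. (?F ^^ r j) (- c)) \<longlonglongrightarrow> - q" unfolding it by (intro tendsto_intros lim)
    qed (use F in auto)
    then show ?thesis by simp
  qed
qed

subsection \<open>Equivariant embeddings\<close>

lemma group_GL2: "group GL2"
proof (rule groupI)
  fix A assume "A \<in> carrier GL2"
  then obtain B where "A ** B = mat 1" "B ** A = mat 1"
    by (auto simp: GL2_def invertible_def)
  then show "\<exists>B\<in>carrier GL2. B \<otimes>\<^bsub>GL2\<^esub> A = \<one>\<^bsub>GL2\<^esub>"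
    by (auto simp: GL2_def invertible_def)
qed (auto simp: GL2_def invertible_mult matrix_mul_assoc invertible_def[of "mat 1"]
    intro!: exI[of _ "mat 1"])

text \<open>Commuting with \<open>f\<close> is preserved under products and inverses and, by
  continuity, under limits. The hull adds nothing, so membership of \<open>kappa\<close> means
  genuine commutation with \<open>f\<close>.\<close>

lemma symmetry_group_eq:
  assumes f: "continuous_on UNIV f"
  shows "symmetry_group f = symmetries f"
  unfolding symmetry_group_def
proof (rule hull_same)
  interpret group GL2 by (rule group_GL2)
  have GL2: "x \<otimes>\<^bsub>GL2\<^esub> y = x ** y" "\<one>\<^bsub>GL2\<^esub> = mat 1" for x y by (auto simp: GL2_def)
  have "subgroup (symmetries f) GL2"
  proof (rule subgroupI)
    show "symmetries f \<subseteq> carrier GL2" by (auto simp: symmetries_def)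
    have "\<one>\<^bsub>GL2\<^esub> \<in> symmetries f"
      using one_closed unfolding symmetries_def by (auto simp: GL2(2))
    then show "symmetries f \<noteq> {}" by blast
    show "A \<otimes>\<^bsub>GL2\<^esub> B \<in> symmetries f" if "A \<in> symmetries f" "B \<in> symmetries f" for A B
      using that m_closed[of A B]
      by (auto simp: symmetries_def GL2 matrix_vector_mul_assoc[symmetric])
    show "inv\<^bsub>GL2\<^esub> A \<in> symmetries f" if A: "A \<in> symmetries f" for A
    proof -
      let ?B = "inv\<^bsub>GL2\<^esub> A"
      have c: "A \<in> carrier GL2" and fA: "\<And>x. f (A *v x) = A *v f x"
        using A by (auto simp: symmetries_def)
      have B: "A ** ?B = mat 1" "?B ** A = mat 1"
        using r_inv[OF c] l_inv[OF c] by (auto simp: GL2)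
      have "f (?B *v x) = ?B *v f x" for x
      proof -
        have "?B *v f x = ?B *v f (A *v (?B *v x))"
          by (simp add: matrix_vector_mul_assoc B)
        also have "\<dots> = ?B *v (A *v f (?B *v x))"
          by (simp only: fA)
        also have "\<dots> = f (?B *v x)"
          by (simp add: matrix_vector_mul_assoc B)
        finally show ?thesis by simp
      qed
      then show ?thesis using c by (simp add: symmetries_def)
    qed
  qed
  moreover have "closedin (top_of_set (carrier GL2)) (symmetries f)"
  proof -
    have cl: "closed {A :: real^2^2. f (A *v x) = A *v f x}" for x
    proof (rule closed_Collect_eq)
      have m: "continuous_on UNIV (\<lambda>A :: real^2^2. A *v y)" for y
        by (intro linear_continuous_on bounded_linearI') 
          (auto simp: matrix_vector_mult_add_rdistrib scaleR_matrix_vector_assoc)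
      show "continuous_on UNIV (\<lambda>A :: real^2^2. f (A *v x))"
        by (intro continuous_on_compose2[OF f] m) auto
      show "continuous_on UNIV (\<lambda>A :: real^2^2. A *v f x)" by (rule m)
    qed
    have "symmetries f = carrier GL2 \<inter> (\<Inter>x. {A. f (A *v x) = A *v f x})"
      by (auto simp: symmetries_def)
    then show ?thesis using cl by (simp only:) (intro closedin_closed_Int closed_INT ballI)
  qed
  ultimately show "closed_subgroup_GL2 (symmetries f)"
    by (simp add: closed_subgroup_GL2_def)
qed

section \<open>Complex coordinates and maps commuting with conjugation\<close>

definition of_complex :: "complex \<Rightarrow> plane" where
  "of_complex z = vector [Re z, Im z]"

lemma of_complex [simp]:
  "to_complex (of_complex z) = z" "of_complex (to_complex x) = x"
  "of_complex z $ 1 = Re z" "of_complex z $ 2 = Im z"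
  "Re (to_complex x) = x $ 1" "Im (to_complex x) = x $ 2" "of_complex 0 = 0" "to_complex 0 = 0"
  by (auto simp: of_complex_def to_complex_def vec_eq_iff forall_2 complex_eq_iff)

lemma continuous_on_to_complex: "continuous_on S to_complex"
  unfolding to_complex_def Complex_eq by (intro continuous_intros)

lemma continuous_on_of_complex: "continuous_on S of_complex"
proof -
  have *: "of_complex = (\<lambda>z. \<chi> i. if i = 1 then Re z else Im z)"
    by (auto simp: of_complex_def fun_eq_iff vec_eq_iff forall_2)
  have "continuous_on S (\<lambda>z. if i = 1 then Re z else Im z)" for i :: 2
    by (cases "i = 1") (simp_all add: continuous_on_Re continuous_on_Im continuous_on_id)
  then show ?thesis
    unfolding * by (rule continuous_on_vec_lambda)
qed

definition cconj :: "(plane \<Rightarrow> plane) \<Rightarrow> complex \<Rightarrow> complex" where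
  "cconj f = to_complex \<circ> f \<circ> of_complex"

lemma cconj_apply: "cconj f z = to_complex (f (of_complex z))"
  by (simp add: cconj_def)

lemma cconj_comp: "cconj (f \<circ> g) = cconj f \<circ> cconj g"
  by (auto simp: cconj_def)

lemma cconj_funpow: "(cconj f ^^ n) (to_complex x) = to_complex ((f ^^ n) x)"
  by (induction n) (auto simp: cconj_def)

lemma continuous_on_cconj:
  assumes "continuous_on UNIV f"
  shows "continuous_on UNIV (cconj f)"
  unfolding cconj_def
  by (intro continuous_on_compose continuous_on_of_complex continuous_on_to_complex
      continuous_on_subset[OF assms]) auto

lemma inj_cconj: "inj f \<Longrightarrow> inj (cconj f)"
  unfolding inj_def cconj_apply by (metis of_complex(1,2))

text \<open>The axis is the fixed set of conjugation, so by injectivity exactly the axis is mapped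
  into the axis. The image of the upper half-plane is connected and avoids it; conjugation settles
  the lower half-plane.\<close>

lemma equivariant_sgn_cases:
  assumes F: "continuous_on UNIV F" "inj F" "\<And>z. F (cnj z) = cnj (F z)"
  shows "(\<forall>z. sgn (Im (F z)) = sgn (Im z)) \<or> (\<forall>z. sgn (Im (F z)) = - sgn (Im z))"
proof -
  have zero: "Im (F z) = 0 \<longleftrightarrow> Im z = 0" for z
  proof -
    have R: "Im w = 0 \<longleftrightarrow> cnj w = w" for w by (auto simp: complex_eq_iff)
    show ?thesis unfolding R using F(2,3) by (metis injD)
  qed
  define U where "U = {z. Im z > 0}"
  have "connected (F ` U)"
    unfolding U_def by (rule connected_continuous_image[OF continuous_on_subset[OF F(1) subset_UNIV]
          convex_connected[OF convex_halfspace_Im_gt]])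
  then have con: "connected (Im ` F ` U)"
    by (rule connected_continuous_image[OF continuous_on_Im[OF continuous_on_id]])
  have "0 \<notin> Im ` F ` U" using zero by (auto simp: U_def)
  then have "(\<forall>z\<in>U. Im (F z) > 0) \<or> (\<forall>z\<in>U. Im (F z) < 0)"
  proof -
    have "Im (F z) > 0" if "z \<in> U" "w \<in> U" "Im (F w) > 0" for z w
    proof (rule ccontr)
      assume "\<not> ?thesis"
      then have "0 \<in> {Im (F z)..Im (F w)}" using that by auto
      then have "0 \<in> Im ` F ` U"
        using connected_contains_Icc[OF con, of "Im (F z)" "Im (F w)"] that by blast
      then show False using \<open>0 \<notin> Im ` F ` U\<close> by blast
    qed
    moreover have "Im (F z) \<noteq> 0" if "z \<in> U" for z using that zero by (auto simp: U_def)
    ultimately show ?thesis by (meson linorder_neqE_linordered_idom)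
  qed
  then show ?thesis
  proof
    assume *: "\<forall>z\<in>U. Im (F z) > 0"
    have "sgn (Im (F z)) = sgn (Im z)" for z
      using bspec[OF *, of z] bspec[OF *, of "cnj z"] zero[of z] F(3)[of z]
      by (cases "Im z" "0::real" rule: linorder_cases) (auto simp: U_def)
    then show ?thesis by blast
  next
    assume *: "\<forall>z\<in>U. Im (F z) < 0"
    have "sgn (Im (F z)) = - sgn (Im z)" for z
      using bspec[OF *, of z] bspec[OF *, of "cnj z"] zero[of z] F(3)[of z]
      by (cases "Im z" "0::real" rule: linorder_cases) (auto simp: U_def)
    then show ?thesis by blast
  qed
qed

lemma real_axis_monotone_cases:
  assumes F: "continuous_on UNIV F" "inj F" "\<And>z. Im z = 0 \<Longrightarrow> Im (F z) = 0"
  shows "strict_mono (\<lambda>x. Re (F (of_real x))) \<or> strict_antimono_on UNIV (\<lambda>x. Re (F (of_real x)))"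
proof -
  have "continuous_on UNIV (\<lambda>x. Re (F (complex_of_real x)))"
    by (intro continuous_intros continuous_on_compose2[OF F(1)]) auto
  moreover have "inj (\<lambda>x. Re (F (complex_of_real x)))"
  proof (rule injI)
    fix x y :: real assume "Re (F x) = Re (F y)"
    then have "F x = F y" using F(3) by (simp add: complex_eq_iff)
    then show "x = y" using F(2) by (metis injD of_real_eq_iff)
  qed
  ultimately show ?thesis
    using injective_eq_monotone_map[of UNIV "\<lambda>x. Re (F (complex_of_real x))"] by simp
qed

text \<open>Keeping the half-planes but reversing the axis makes \<open>F\<close> on the unit circle
  linearly homotopic to the reflection \<open>z \<mapsto> - cnj z\<close> in the punctured
  plane.\<close>

lemma winding_number_reversed_circle:
  assumes F: "continuous_on UNIV F" "\<And>z. sgn (Im (F z)) = sgn (Im z)" "F 0 = 0"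
    and anti: "Re (F 1) < 0" "Re (F (- 1)) > 0"
  shows "winding_number (F \<circ> circlepath 0 1) 0 = - 1"
proof -
  let ?c = "circlepath 0 1 :: real \<Rightarrow> complex"
  let ?k = "cnj \<circ> shiftpath (1/2) ?c"
  \<comment> \<open>Starting the circle half a turn later multiplies it by \<open>-1\<close>. The
    reflected circle is thus a conjugated shifted circle, whose winding number is known.\<close>
  have k: "?k t = - cnj (?c t)" if "t \<in> {0..1}" for t
  proof -
    have e: "exp (complex_of_real (2 * pi) * \<i> * (1/2 + of_real t)) = - exp (of_real (2 * pi) * \<i> * of_real t)"
    proof -
      have "complex_of_real (2 * pi) * \<i> * (1/2 + of_real t) = of_real (2 * pi) * \<i> * of_real t + pi * \<i>"
        by (simp add: algebra_simps)
      then show ?thesis by (simp only: exp_add exp_pi_i) simp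
    qed
    have "exp (complex_of_real (2 * pi) * \<i> * (1/2 + of_real t - 1))
        = exp (complex_of_real (2 * pi) * \<i> * (1/2 + of_real t))"
    proof -
      have "complex_of_real (2 * pi) * \<i> * (1/2 + of_real t - 1)
          = complex_of_real (2 * pi) * \<i> * (1/2 + of_real t) - 2 * of_real pi * \<i>"
        by (simp add: algebra_simps)
      then show ?thesis by (simp only: exp_diff exp_two_pi_i) simp
    qed
    then show ?thesis
      using e by (simp add: shiftpath_def circlepath)
  qed
  have ps: "path (shiftpath (1/2) ?c)" "0 \<notin> path_image (shiftpath (1/2) ?c)"
    by (auto simp: path_shiftpath path_image_shiftpath)
  have "winding_number ?k 0 = - 1"
    using winding_number_cnj[OF ps] by (simp add: winding_number_shiftpath winding_number_circlepath_centre)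
  moreover have "homotopic_loops (- {0}) (F \<circ> ?c) ?k"
  proof (rule homotopic_loops_linear)
    show "path (F \<circ> ?c)"
      by (intro path_continuous_image continuous_on_subset[OF F(1)]) auto
    show "path ?k" by (intro path_continuous_image ps continuous_intros)
    show "pathfinish (F \<circ> ?c) = pathstart (F \<circ> ?c)"
      by (simp add: pathfinish_compose pathstart_compose)
    show "pathfinish ?k = pathstart ?k"
      by (simp add: pathfinish_compose pathstart_compose pathfinish_shiftpath pathstart_shiftpath)
    fix t :: real assume t: "t \<in> {0..1}"
    define z where "z = ?c t"
    have nz: "norm z = 1" by (simp add: z_def circlepath norm_exp_eq_Re)
    show "closed_segment ((F \<circ> ?c) t) (?k t) \<subseteq> - {0}"
    proof -
      have "0 \<notin> closed_segment (F z) (- cnj z)"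
      proof
        assume "0 \<in> closed_segment (F z) (- cnj z)"
        then obtain u where u: "0 \<le> u" "u \<le> 1" "0 = (1 - u) *\<^sub>R F z + u *\<^sub>R (- cnj z)"
          by (auto simp: closed_segment_def)
        have Im: "0 = (1 - u) * Im (F z) + u * Im z" and Re: "0 = (1 - u) * Re (F z) - u * Re z"
          using arg_cong[OF u(3), of Im] arg_cong[OF u(3), of Re] by auto
        \<comment> \<open>A convex combination of two nonzero reals of equal sign cannot vanish. It
          is applied to imaginary parts off the axis and to real parts at \<open>1\<close> and
          \<open>-1\<close>.\<close>
        have pos: False if "a * b > 0" "0 = (1 - u) * a + u * b" for a b :: real
        proof -
          have "0 = (1 - u) * (a * a) + u * (a * b)"
            using arg_cong[OF that(2), of "\<lambda>x. a * x"] by (simp add: algebra_simps)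
          moreover have "a * a > 0" using that(1) by (auto simp: zero_less_mult_iff)
          moreover have "(1 - u) * (a * a) \<ge> 0" "u * (a * b) \<ge> 0" using u that(1) calculation by auto
          ultimately have "(1 - u) * (a * a) = 0" "u * (a * b) = 0" by linarith+
          then show False using that(1) \<open>a * a > 0\<close> by auto
        qed
        show False
        proof (cases "Im z = 0")
          case False
          have "Im (F z) * Im z > 0"
            using F(2)[of z] False by (auto simp: sgn_if zero_less_mult_iff split: if_splits)
          then show False using pos Im by blast
        next
          case True
          then have "\<bar>Re z\<bar> = 1" using nz by (simp add: cmod_eq_Re)
          then have "z = 1 \<or> z = - 1" using True by (auto simp: complex_eq_iff abs_if split: if_splits)
          then have "Re (F z) * (- Re z) > 0"
            using anti by auto
          then show False using pos[of "Re (F z)" "- Re z"] Re by simp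
        qed
      qed
      then show ?thesis using k[OF t] by (auto simp: z_def)
    qed
  qed
  ultimately show ?thesis using winding_number_homotopic_loops by metis
qed

text \<open>The second coordinate has no zero on a component and the component is connected, so
  \<open>p\<close> and \<open>f p\<close> lie on the same side of the axis.\<close>

lemma not_interchanging_upper:
  fixes f :: "plane \<Rightarrow> plane" and p :: plane
  assumes f: "not_interchanging f" and p: "p $ 2 > 0"
  shows "f p $ 2 > 0"
proof -
  have "p \<in> \<Union> (components (- Fix_kappa))"
    using p by (simp add: Fix_kappa_eq)
  then obtain C where C: "C \<in> components (- Fix_kappa)" "p \<in> C" by blast
  have fp: "f p \<in> C" using f C unfolding not_interchanging_def by blast
  have con: "connected ((\<lambda>x :: plane. x $ 2) ` C)"
    using C by (intro connected_continuous_image continuous_on_component in_components_connected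
        continuous_on_id)
  have "0 \<notin> (\<lambda>x :: plane. x $ 2) ` C"
    using in_components_subset[OF C(1)] by (auto simp: Fix_kappa_eq)
  moreover have "{f p $ 2..p $ 2} \<subseteq> (\<lambda>x :: plane. x $ 2) ` C"
    using connected_contains_Icc[OF con imageI[OF fp] imageI[OF C(2)]] .
  ultimately have "0 \<notin> {f p $ 2..p $ 2}" by blast
  then show ?thesis using p by simp
qed

text \<open>The only possible limit point is \<open>0\<close>, which lies in every neighbourhood
  witnessing the local repellor.\<close>

lemma half_plane_map_repels:
  assumes F: "half_plane_map (cconj f)" "Fix f = {0}" and r: "local_repellor f"
  shows "omega_limit f p = {} \<or> p = 0"
proof (rule ccontr)
  assume "\<not> ?thesis"
  then obtain q n where p: "p \<noteq> 0" and n: "filterlim n at_top sequentially"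
    and lim: "(\<lambda>j. (f ^^ n j) p) \<longlonglongrightarrow> q"
    by (auto simp: omega_limit_def)
  have "to_complex q = 0"
  proof (rule half_plane_map_limit_zero[OF F(1) _ _ _ n])
    have fx: "f x = x \<longleftrightarrow> x = 0" for x using F(2) by (auto simp: Fix_def)
    show "cconj f 0 = 0" using fx[of 0] by (simp add: cconj_apply)
    show "z = 0" if "cconj f z = z" for z
      using that fx[of "of_complex z"] by (metis cconj_apply of_complex(1,2,8))
    show "to_complex p \<noteq> 0" using p by (metis of_complex(2,7))
    show "(\<lambda>j. (cconj f ^^ n j) (to_complex p)) \<longlonglongrightarrow> to_complex q"
      unfolding cconj_funpow
      by (rule continuous_on_tendsto_compose[OF continuous_on_to_complex[of UNIV] lim]) auto
  qed
  then have "q = 0" by (metis of_complex(2,7))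
  then have "0 \<in> omega_limit f p" using n lim by (auto simp: omega_limit_def)
  then show False
    using r p interior_subset unfolding local_repellor_def repels_from_def by blast
qed

section \<open>Passing to the second iterate\<close>

lemma omega_limit_comp_subset: "omega_limit (f \<circ> f) p \<subseteq> omega_limit f p"
proof
  fix q assume "q \<in> omega_limit (f \<circ> f) p"
  then obtain n where n: "filterlim n at_top sequentially" "(\<lambda>j. ((f \<circ> f) ^^ n j) p) \<longlonglongrightarrow> q"
    by (auto simp: omega_limit_def)
  have "f \<circ> f = f ^^ 2" by (simp add: numeral_2_eq_2)
  then have "(f \<circ> f) ^^ k = f ^^ (2 * k)" for k by (simp only: funpow_mult)
  moreover have "filterlim (\<lambda>j. 2 * n j) at_top sequentially"
    by (rule filterlim_at_top_mono[OF n(1)]) auto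
  ultimately show "q \<in> omega_limit f p"
    using n(2) unfolding omega_limit_def by auto
qed

lemma local_repellor_comp:
  assumes "local_repellor f"
  shows "local_repellor (f \<circ> f)"
proof -
  obtain V where V: "0 \<in> interior V" "repels_from f V" using assms by (auto simp: local_repellor_def)
  then have "repels_from (f \<circ> f) V"
    using omega_limit_comp_subset[of f] by (force simp: repels_from_def Fix_def)
  then show ?thesis using V by (auto simp: local_repellor_def)
qed

lemma filterlim_at_top_even_odd:
  fixes s :: "nat \<Rightarrow> 'a::linorder"
  assumes "filterlim (\<lambda>k. s (2 * k)) at_top sequentially"
    and "filterlim (\<lambda>k. s (2 * k + 1)) at_top sequentially"
  shows "filterlim s at_top sequentially"
  unfolding filterlim_at_top
proof
  fix Z
  obtain M N where M: "\<And>k. k \<ge> M \<Longrightarrow> Z \<le> s (2 * k)" and N: "\<And>k. k \<ge> N \<Longrightarrow> Z \<le> s (2 * k + 1)"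
    using assms unfolding filterlim_at_top eventually_sequentially by meson
  have "Z \<le> s n" if "n \<ge> 2 * (M + N)" for n
    using that M[of "n div 2"] N[of "n div 2"] by (cases "even n") (auto elim!: evenE oddE)
  then show "\<forall>\<^sub>F n in sequentially. Z \<le> s n"
    unfolding eventually_sequentially by blast
qed

text \<open>The orbits of \<open>p\<close> and \<open>f p\<close> under \<open>f \<circ> f\<close>
  are the even and odd parts of the orbit of \<open>p\<close>; if both escape to infinity, so does
  the whole orbit.\<close>

lemma omega_limit_comp_empty:
  assumes "omega_limit (f \<circ> f) p = {}" "omega_limit (f \<circ> f) (f p) = {}"
  shows "omega_limit f p = {}"
proof -
  have "f \<circ> f = f ^^ 2" by (simp add: numeral_2_eq_2)
  then have it: "(f \<circ> f) ^^ k = f ^^ (2 * k)" for k by (simp only: funpow_mult)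
  have "filterlim (\<lambda>k. norm ((f ^^ (2 * k)) p)) at_top sequentially"
    using assms(1) unfolding omega_limit_empty_iff it .
  moreover have "filterlim (\<lambda>k. norm ((f ^^ (2 * k + 1)) p)) at_top sequentially"
    using assms(2) unfolding omega_limit_empty_iff it by (simp add: funpow_swap1)
  ultimately show ?thesis
    unfolding omega_limit_empty_iff by (rule filterlim_at_top_even_odd)
qed

theorem theorem3p8:
  fixes f :: "real ^ 2 \<Rightarrow> real ^ 2"
  assumes "f \<in> Emb"
    and "compact (symmetry_group f)"
    and "kappa \<in> symmetry_group f"
    and "Fix f = {0}"
    and "(f \<in> Emb_plus \<and> not_interchanging f) \<or> (\<nexists>S. two_periodic_orbit f S)"
    and "local_repellor f"
  shows "global_repellor f"
proof -
  have f: "continuous_on UNIV f" "inj f" using assms(1) by (auto simp: Emb_def)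
  have fx: "f x = x \<longleftrightarrow> x = 0" for x using assms(4) by (auto simp: Fix_def)
  let ?F = "cconj f"
  have F: "continuous_on UNIV ?F" "inj ?F" using f continuous_on_cconj inj_cconj by auto
  have F0: "?F 0 = 0" using fx[of 0] by (simp add: cconj_apply)
  have kap: "f (kappa *v x) = kappa *v f x" for x
    using assms(3) symmetry_group_eq[OF f(1)] by (auto simp: symmetries_def)
  have "?F (cnj z) = cnj (?F z)" for z
    using kap[of "of_complex z"]
    by (simp add: cconj_apply kappa_apply to_complex_def of_complex_def complex_eq_iff)
  note F = F this
  have sgn: "(\<forall>z. sgn (Im (?F z)) = sgn (Im z)) \<or> (\<forall>z. sgn (Im (?F z)) = - sgn (Im z))"
    by (rule equivariant_sgn_cases[OF F])
  have real: "Im (?F z) = 0" if "Im z = 0" for z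
    using sgn that by (metis neg_equal_0_iff_equal sgn_0_0)
  have mono: "strict_mono (\<lambda>x. Re (?F (of_real x))) \<or> strict_antimono_on UNIV (\<lambda>x. Re (?F (of_real x)))"
    by (rule real_axis_monotone_cases[OF F(1,2) real])
  have "omega_limit f p = {}" if p: "p \<noteq> 0" for p
    using assms(5)
  proof
    assume a: "f \<in> Emb_plus \<and> not_interchanging f"
    have "Im (?F \<i>) > 0"
      using not_interchanging_upper[of f "of_complex \<i>"] a by (simp add: cconj_apply)
    then have "sgn (Im (?F \<i>)) \<noteq> - sgn (Im \<i>)" by simp
    then have sg: "\<forall>z. sgn (Im (?F z)) = sgn (Im z)" using sgn by blast
    \<comment> \<open>A decreasing axis map would give winding number \<open>-1\<close> on the unit
      circle, against preservation of orientation.\<close>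
    have "strict_mono (\<lambda>x. Re (?F (of_real x)))"
    proof (rule ccontr)
      assume "\<not> ?thesis"
      then have "strict_antimono_on UNIV (\<lambda>x. Re (?F (of_real x)))" using mono by blast
      then have anti: "Re (?F (of_real y)) < Re (?F (of_real x))" if "x < y" for x y
        using that by (auto simp: monotone_on_def)
      have "circle_about 0 1 = of_complex \<circ> circlepath 0 1"
        by (auto simp: fun_eq_iff circle_about_def of_complex_def circlepath Re_exp Im_exp
            vec_eq_iff forall_2 mult_ac)
      then have "winding_number (?F \<circ> circlepath 0 1) 0 = 1"
        using a fx[of 0] unfolding Emb_plus_def orientation_preserving_def cconj_def
        by (metis (mono_tags, lifting) comp_assoc mem_Collect_eq of_complex(8) zero_less_one)
      moreover have "winding_number (?F \<circ> circlepath 0 1) 0 = - 1"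
        using anti[of 0 1] anti[of "-1" 0] F0 sg
        by (intro winding_number_reversed_circle F) auto
      ultimately show False by simp
    qed
    then have "half_plane_map ?F"
      using F sg by (auto simp: half_plane_map_def strict_mono_def)
    then show ?thesis using half_plane_map_repels[OF _ assms(4,6)] p by blast
  next
    assume b: "\<nexists>S. two_periodic_orbit f S"
    \<comment> \<open>A nonzero fixed point of \<open>f \<circ> f\<close> is not fixed by
      \<open>f\<close>, hence would span a 2-periodic orbit.\<close>
    have ff: "Fix (f \<circ> f) = {0}"
      using b fx unfolding Fix_def two_periodic_orbit_def by (auto simp: set_eq_iff) metis+
    \<comment> \<open>Whether \<open>f\<close> exchanges the half-planes or reverses the axis,
      applying it twice undoes both.\<close>
    have "half_plane_map (cconj (f \<circ> f))"
      unfolding half_plane_map_def cconj_comp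
    proof (intro conjI allI impI)
      show "continuous_on UNIV (?F \<circ> ?F)"
        by (intro continuous_on_compose F continuous_on_subset[OF F(1)]) auto
      show "inj (?F \<circ> ?F)" using F by (simp add: inj_compose)
      show "sgn (Im ((?F \<circ> ?F) z)) = sgn (Im z)" for z using sgn by auto
      fix x y :: real assume xy: "x < y"
      have R: "?F (of_real t) = of_real (Re (?F (of_real t)))" for t
        using real[of "of_real t"] by (simp add: complex_eq_iff)
      have RR: "Re ((?F \<circ> ?F) (of_real t)) = Re (?F (of_real (Re (?F (of_real t)))))" for t
        by (subst R[symmetric]) simp
      show "Re ((?F \<circ> ?F) x) < Re ((?F \<circ> ?F) y)"
        unfolding RR using mono xy by (auto simp: monotone_on_def)
    qed
    then have e: "omega_limit (f \<circ> f) x = {}" if "x \<noteq> 0" for x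
      using half_plane_map_repels[OF _ ff local_repellor_comp[OF assms(6)]] that by blast
    have "f p \<noteq> 0" using p fx[of 0] injD[OF f(2), of p 0] by auto
    then show ?thesis using omega_limit_comp_empty e p by blast
  qed
  then show ?thesis
    using fx[of 0] by (simp add: global_repellor_def repels_from_def Fix_def)
qed

end
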